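(* Let $A_0,A_1$ be real $2\times 2$ matrices satisfying conditions (A1)-(A3) of the context, let $f$ be the associated de Rham function, $\mu_f$ the associated probability measure, and let $\alpha,\beta,p_0,s$ be as in the context. Then: (1) There exists a Borel set $K_0$ such that $\mu_f(K_0)=1$ and $\dim_H(K_0)\le \max\{s(p_0(y)) : y\in[\alpha,\beta]\}/\log 2$. (2) $\mu_f(K)=0$ for any Borel set $K$ with $\dim_H(K)<\min\{s(p_0(y)) : y\in[\alpha,\beta]\}/\log 2$.
   Context: For a real $2\times2$ matrix $A=\begin{pmatrix} a&b\\c&d\end{pmatrix}$ and $z\in\mathbb{R}$ put $\Phi(A;z)=\frac{az+b}{cz+d}$. The matrices $A_i=\begin{pmatrix} a_i&b_i\\c_i&d_i\end{pmatrix}$, $i=0,1$, satisfy: (A1) $0=b_0<\frac{a_0+b_0}{c_0+d_0}=\frac{b_1}{d_1}<\frac{a_1+b_1}{c_1+d_1}=1$; (A2) $a_id_i-b_ic_i>0$, $i=0,1$; (A3) $(a_id_i-b_ic_i)^{1/2}<\min\{d_i,c_i+d_i\}$, $i=0,1$. Under these conditions $F_i=\Phi(A_i;\cdot)$ are strictly increasing contractions of $[0,1]$ with $0=F_0(0)<F_0(1)=F_1(0)<F_1(1)=1$, and (de Rham) there is a unique continuous strictly increasing $f:[0,1]\to[0,1]$ with $f(x)=F_0(f(2x))$ for $0\le x\le 1/2$ and $f(x)=F_1(f(2x-1))$ for $1/2\le x\le 1$. $\mu_f$ is the Borel probability measure on $[0,1]$ whose distribution function is $f$. Define $\alpha=\min\{0,\,c_0/(d_0-a_0),\,c_1/b_1\}$,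 $\beta=\max\{0,\,c_0/(d_0-a_0),\,c_1/b_1\}$, $\gamma=1/\Phi(A_0;1)>1$, $p_0(x)=(x+1)/(x+\gamma)$ for $x>-\gamma$, and $s(p)=-p\log p-(1-p)\log(1-p)$ for $p\in[0,1]$ (with $0\log 0=0$). $\dim_H$ denotes Hausdorff dimension. *)

theory Defs
  imports "HOL-Analysis.Analysis" "HOL-Probability.Distribution_Functions"
begin

section \<open>Hausdorff measure and Hausdorff dimension\<close>

text \<open>
  The contribution \<open>(diam U)\<^sup>s\<close> of a covering set, with the usual conventions \<open>0\<^sup>0 = 1\<close> for
  nonempty sets and value 0 for the empty set. They are spelled out because \<open>0 powr 0 = 0\<close>.
\<close>

definition hausdorff_gauge :: "real \<Rightarrow> 'a::metric_space set \<Rightarrow> ennreal" where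
  "hausdorff_gauge s U =
     (if U = {} then 0 else if s = 0 then 1 else ennreal (diameter U powr s))"

text \<open>
  Boundedness is required explicitly because \<^const>\<open>diameter\<close> is unspecified on
  unbounded sets.
\<close>

definition hausdorff_content :: "real \<Rightarrow> real \<Rightarrow> 'a::metric_space set \<Rightarrow> ennreal" where
  "hausdorff_content s \<delta> S =
     (INF U\<in>{U :: nat \<Rightarrow> 'a set. S \<subseteq> (\<Union>i. U i) \<and> (\<forall>i. bounded (U i) \<and> diameter (U i) \<le> \<delta>)}.
        \<Sum>i. hausdorff_gauge s (U i))"

text \<open>The content is antitone in \<open>\<delta>\<close>, so the supremum is the limit as \<open>\<delta>\<close> tends to 0.\<close>

definition hausdorff_measure :: "real \<Rightarrow> 'a::metric_space set \<Rightarrow> ennreal" where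
  "hausdorff_measure s S = (SUP \<delta>\<in>{0<..}. hausdorff_content s \<delta> S)"

definition hausdorff_dim :: "'a::metric_space set \<Rightarrow> ereal" where
  "hausdorff_dim S = Inf {ereal s | s. 0 \<le> s \<and> hausdorff_measure s S = 0}"

section \<open>De Rham functions\<close>

text \<open>
  A matrix with rows \<open>(a, b)\<close> and \<open>(c, d)\<close> is an \<open>A :: real^2^2\<close> with \<open>a = A$1$1\<close>,
  \<open>b = A$1$2\<close>, \<open>c = A$2$1\<close>, \<open>d = A$2$2\<close>.
\<close>

definition Phi :: "real^2^2 \<Rightarrow> real \<Rightarrow> real" where
  "Phi A z = (A$1$1 * z + A$1$2) / (A$2$1 * z + A$2$2)"

definition cond_A1 :: "real^2^2 \<Rightarrow> real^2^2 \<Rightarrow> bool" where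
  "cond_A1 A0 A1 \<longleftrightarrow>
     0 = A0$1$2 \<and>
     A0$1$2 < (A0$1$1 + A0$1$2) / (A0$2$1 + A0$2$2) \<and>
     (A0$1$1 + A0$1$2) / (A0$2$1 + A0$2$2) = A1$1$2 / A1$2$2 \<and>
     A1$1$2 / A1$2$2 < (A1$1$1 + A1$1$2) / (A1$2$1 + A1$2$2) \<and>
     (A1$1$1 + A1$1$2) / (A1$2$1 + A1$2$2) = 1"

definition cond_A2 :: "real^2^2 \<Rightarrow> bool" where
  "cond_A2 A \<longleftrightarrow> A$1$1 * A$2$2 - A$1$2 * A$2$1 > 0"

definition cond_A3 :: "real^2^2 \<Rightarrow> bool" where
  "cond_A3 A \<longleftrightarrow> sqrt (A$1$1 * A$2$2 - A$1$2 * A$2$1) < min (A$2$2) (A$2$1 + A$2$2)"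

text \<open>Only the values of \<open>f\<close> on \<open>[0,1]\<close> are constrained.\<close>

definition de_rham_function :: "real^2^2 \<Rightarrow> real^2^2 \<Rightarrow> (real \<Rightarrow> real) \<Rightarrow> bool" where
  "de_rham_function A0 A1 f \<longleftrightarrow>
     continuous_on {0..1} f \<and> strict_mono_on {0..1} f \<and> f ` {0..1} \<subseteq> {0..1} \<and>
     (\<forall>x. 0 \<le> x \<and> x \<le> 1/2 \<longrightarrow> f x = Phi A0 (f (2 * x))) \<and>
     (\<forall>x. 1/2 \<le> x \<and> x \<le> 1 \<longrightarrow> f x = Phi A1 (f (2 * x - 1)))"

text \<open>
  A Borel probability measure on \<open>[0,1]\<close> is represented as a Borel probability measure on the
  real line that gives full mass to \<open>[0,1]\<close>.
\<close>

definition unit_interval_distribution :: "(real \<Rightarrow> real) \<Rightarrow> real measure \<Rightarrow> bool" where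
  "unit_interval_distribution f M \<longleftrightarrow>
     real_distribution M \<and> measure M {0..1} = 1 \<and> (\<forall>x\<in>{0..1}. cdf M x = f x)"

definition alpha :: "real^2^2 \<Rightarrow> real^2^2 \<Rightarrow> real" where
  "alpha A0 A1 = Min {0, A0$2$1 / (A0$2$2 - A0$1$1), A1$2$1 / A1$1$2}"

definition beta :: "real^2^2 \<Rightarrow> real^2^2 \<Rightarrow> real" where
  "beta A0 A1 = Max {0, A0$2$1 / (A0$2$2 - A0$1$1), A1$2$1 / A1$1$2}"

definition gamma :: "real^2^2 \<Rightarrow> real" where
  "gamma A0 = 1 / Phi A0 1"

definition p0 :: "real^2^2 \<Rightarrow> real \<Rightarrow> real" where
  "p0 A0 x = (x + 1) / (x + gamma A0)"

definition binary_entropy :: "real \<Rightarrow> real" where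
  "binary_entropy p = - p * ln p - (1 - p) * ln (1 - p)"

end

theory Submission
  imports Defs
begin

text \<open>
  By induction along the dyadic tree, \<open>f ((k + t) / 2^n) = (P * f t + Q) / (y * f t + 1)\<close> with
  \<open>y \<in> [\<alpha>, \<beta>]\<close>: passing to a child moves \<open>y\<close> by \<open>y \<mapsto> (a\<^sub>0 y + c\<^sub>0) / d\<^sub>0\<close> or
  \<open>y \<mapsto> (a\<^sub>1 y + c\<^sub>1) / (b\<^sub>1 y + d\<^sub>1)\<close>, increasing maps attracted to the fixed points
  \<open>c\<^sub>0 / (d\<^sub>0 - a\<^sub>0)\<close> and \<open>c\<^sub>1 / b\<^sub>1\<close>. Hence the left half of a dyadic interval carries the
  fraction \<open>p\<^sub>0(y)\<close> of its mass, and all conditional entropies lie between the minimum \<open>h\<close> and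
  the maximum \<open>H\<close> of \<open>s \<circ> p\<^sub>0\<close> on \<open>[\<alpha>, \<beta>]\<close>.

  The moments \<open>\<Sum>\<^sub>k \<mu>(I\<^sub>n\<^sub>,\<^sub>k) powr (1 - \<theta>)\<close> grow by a factor of at most
  \<open>exp (\<theta> * H + O(\<theta>\<^sup>2))\<close> per generation if \<open>\<theta> > 0\<close>, and \<open>exp (\<theta> * h + O(\<theta>\<^sup>2))\<close> if
  \<open>\<theta> < 0\<close>. The Markov inequality and Borel--Cantelli then give, for almost every \<open>x\<close>,
  \<open>exp (-n (H + \<epsilon>)) \<le> \<mu>(I\<^sub>n(x)) \<le> exp (-n (h - \<epsilon>))\<close> for large \<open>n\<close>. Counting the heavy
  intervals bounds the dimension from above; the mass distribution principle bounds it from below.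
\<close>

lemma exp_le_quadratic:
  fixes x :: real
  assumes "\<bar>x\<bar> \<le> 1"
  shows "exp x \<le> 1 + x + x\<^sup>2"
proof (cases "0 \<le> x")
  case True
  then show ?thesis using assms by (intro exp_bound) auto
next
  case False
  \<comment> \<open>As \<open>x ^ 3 \<le> 0\<close>, the identity bounds \<open>1 / (1 - x)\<close>
    by the quadratic; \<open>exp (- x) \<ge> 1 - x\<close> bounds \<open>exp x\<close> by
    \<open>1 / (1 - x)\<close>.\<close>
  have "(1 - x) * (1 + x + x\<^sup>2) = 1 - x ^ 3"
    by (simp add: algebra_simps power2_eq_square power3_eq_cube)
  moreover have "x ^ 3 \<le> 0"
    using False by (simp add: power3_eq_cube mult_nonneg_nonpos mult_nonpos_nonpos)
  ultimately have "1 \<le> (1 - x) * (1 + x + x\<^sup>2)" by simp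
  then have "1 / (1 - x) \<le> 1 + x + x\<^sup>2"
    using False by (simp add: field_simps)
  moreover have "exp x \<le> 1 / (1 - x)"
    using exp_ge_add_one_self[of "-x"] False by (simp add: exp_minus field_simps)
  ultimately show ?thesis by linarith
qed

section \<open>Dyadic intervals\<close>

text \<open>Half-open on the left, so that masses are differences of the distribution function and
  each generation partitions \<open>{0<..1}\<close>.\<close>

definition cell :: "nat \<Rightarrow> nat \<Rightarrow> real set" where
  "cell n k = {real k / 2 ^ n <.. real (Suc k) / 2 ^ n}"

lemma cell_borel [measurable, simp]: "cell n k \<in> sets borel"
  by (simp add: cell_def)

lemma cell_Suc: "cell n k = cell (Suc n) (2 * k) \<union> cell (Suc n) (Suc (2 * k))"
  by (auto simp: cell_def field_simps)

lemma cell_Suc_disjoint: "cell (Suc n) (2 * k) \<inter> cell (Suc n) (Suc (2 * k)) = {}"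
  by (auto simp: cell_def field_simps)

lemma cell_disjoint:
  assumes "x \<in> cell n j" "x \<in> cell n k"
  shows "j = k"
proof -
  have "real j < real (Suc k)" "real k < real (Suc j)"
    using assms by (auto simp: cell_def field_simps)
  then show ?thesis by linarith
qed

lemma disjoint_family_cell: "disjoint_family_on (cell n) A"
  using cell_disjoint by (fastforce simp: disjoint_family_on_def)

lemma bounded_cell: "bounded (cell n k)"
  by (rule bounded_subset[OF bounded_closed_interval[of "real k / 2 ^ n" "real (Suc k) / 2 ^ n"]])
    (auto simp: cell_def)

lemma diameter_cell_le: "diameter (cell n k) \<le> 1 / 2 ^ n"
proof (rule diameter_le)
  fix x y assume "x \<in> cell n k" "y \<in> cell n k"
  then show "norm (x - y) \<le> 1 / 2 ^ n"
    by (auto simp: cell_def abs_le_iff add_divide_distrib)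
qed simp

lemma UN_cell: "(\<Union>k<2^n. cell n k) = {0<..1}"
proof (induction n)
  case 0
  then show ?case by (auto simp: cell_def)
next
  case (Suc n)
  have "(\<Union>k<2 ^ Suc n. cell (Suc n) k) = (\<Union>k<2 ^ n. cell n k)"
  proof (intro equalityI subsetI)
    fix x assume "x \<in> (\<Union>k<2 ^ Suc n. cell (Suc n) k)"
    then obtain k where k: "k < 2 ^ Suc n" "x \<in> cell (Suc n) k" by auto
    have "x \<in> cell n (k div 2)"
    proof (cases "even k")
      case True
      then show ?thesis using k by (subst cell_Suc) auto
    next
      case False
      then show ?thesis using k by (subst cell_Suc) auto
    qed
    moreover have "k div 2 < 2 ^ n" using k by auto
    ultimately show "x \<in> (\<Union>k<2 ^ n. cell n k)" by blast
  next
    fix x assume "x \<in> (\<Union>k<2 ^ n. cell n k)"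
    then obtain k where k: "k < 2 ^ n" "x \<in> cell n k" by auto
    then have "x \<in> cell (Suc n) (2 * k) \<or> x \<in> cell (Suc n) (Suc (2 * k))"
      using cell_Suc by blast
    then show "x \<in> (\<Union>k<2 ^ Suc n. cell (Suc n) k)"
    proof
      assume "x \<in> cell (Suc n) (2 * k)"
      moreover have "2 * k < 2 ^ Suc n" using k by simp
      ultimately show ?thesis by blast
    next
      assume "x \<in> cell (Suc n) (Suc (2 * k))"
      moreover have "Suc (2 * k) < 2 ^ Suc n" using k by simp
      ultimately show ?thesis by blast
    qed
  qed
  with Suc show ?case by simp
qed

lemma sum_split_parity:
  fixes g :: "nat \<Rightarrow> 'a::comm_monoid_add"
  shows "(\<Sum>k<2 * N. g k) = (\<Sum>k<N. g (2 * k) + g (Suc (2 * k)))"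
  by (induction N) (auto simp: ac_simps)

text \<open>Take the least \<open>n\<close> with \<open>(1/2) ^ n < 2 * d\<close>; minimality gives
  \<open>d \<le> 1 / 2 ^ n\<close>. This matches a covering set with cells of comparable
  length.\<close>

lemma ex_cell_scale:
  fixes d :: real
  assumes "0 < d" "d \<le> 1 / 2 ^ N"
  obtains n where "N \<le> n" "d \<le> 1 / 2 ^ n" "1 / 2 ^ n < 2 * d"
proof -
  have "\<exists>n. (1/2) ^ n < 2 * d"
    using real_arch_pow_inv[of "2 * d" "1/2"] assms by auto
  then obtain n where n: "(1/2) ^ n < 2 * d" "\<And>m. m < n \<Longrightarrow> \<not> (1/2) ^ m < 2 * d"
    using exists_least_iff[of "\<lambda>n. (1/2) ^ n < 2 * d"] by blast
  have "N \<le> n"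
  proof (rule ccontr)
    assume "\<not> N \<le> n"
    then have "(1/2::real) ^ N \<le> (1/2) ^ Suc n"
      by (intro power_decreasing) auto
    then show False using n assms by (simp add: power_divide)
  qed
  moreover have "d \<le> 1 / 2 ^ n"
  proof (cases n)
    case 0
    then show ?thesis using assms calculation by simp
  next
    case (Suc m)
    then show ?thesis using n(2)[of m] by (simp add: power_divide field_simps)
  qed
  ultimately show thesis using n(1) that by (simp add: power_divide)
qed

section \<open>Elementary bounds for Hausdorff dimension and gauge\<close>

lemma ereal_hausdorff_dim_le:
  assumes "0 \<le> s" "hausdorff_measure s S = 0"
  shows "hausdorff_dim S \<le> ereal s"
  unfolding hausdorff_dim_def using assms by (intro Inf_lower) auto

lemma gauge_cell_le:
  assumes "0 < s"
  shows "hausdorff_gauge s (cell n k) \<le> ennreal (exp (- real n * (s * ln 2)))"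
proof -
  have "diameter (cell n k) powr s \<le> (1 / 2 ^ n) powr s"
    using assms by (intro powr_mono2 diameter_cell_le diameter_ge_0 bounded_cell) auto
  also have "\<dots> = exp (- real n * (s * ln 2))"
    by (simp add: powr_def ln_div ln_realpow algebra_simps)
  finally show ?thesis
    using assms by (auto simp: hausdorff_gauge_def intro: ennreal_leI)
qed

section \<open>Measures with bounded conditional dyadic entropies\<close>

text \<open>No independence is assumed, only uniform bounds on the conditional probabilities
  \<open>p n k\<close> of left halves; \<open>c\<close> keeps their logarithms and those of
  \<open>1 - p n k\<close> above \<open>ln c\<close>.\<close>

locale dyadic_entropy = real_distribution M for M +
  fixes p :: "nat \<Rightarrow> nat \<Rightarrow> real" and c h H :: real
  assumes mass_unit: "measure M {0<..1} = 1"
    and mass_left: "k < 2 ^ n \<Longrightarrow> measure M (cell (Suc n) (2 * k)) = p n k * measure M (cell n k)"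
    and c_pos: "0 < c"
    and p_bounds: "k < 2 ^ n \<Longrightarrow> c \<le> p n k \<and> p n k \<le> 1 - c"
    and entropy_bounds:
      "k < 2 ^ n \<Longrightarrow> h \<le> binary_entropy (p n k) \<and> binary_entropy (p n k) \<le> H"
begin

abbreviation mass :: "nat \<Rightarrow> nat \<Rightarrow> real" where
  "mass n k \<equiv> measure M (cell n k)"

lemma mass_right:
  assumes "k < 2 ^ n"
  shows "mass (Suc n) (Suc (2 * k)) = (1 - p n k) * mass n k"
proof -
  have "mass n k = mass (Suc n) (2 * k) + mass (Suc n) (Suc (2 * k))"
    by (subst cell_Suc, rule finite_measure_Union) (auto simp: cell_Suc_disjoint)
  then show ?thesis using mass_left[OF assms] by (simp add: algebra_simps)
qed

lemma p_strict: "k < 2 ^ n \<Longrightarrow> 0 < p n k \<and> p n k < 1"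
  using p_bounds[of k n] c_pos by auto

lemma mass_pos: "k < 2 ^ n \<Longrightarrow> 0 < mass n k"
proof (induction n arbitrary: k)
  case 0
  then show ?case using mass_unit by (simp add: cell_def)
next
  case (Suc n)
  then have k: "k div 2 < 2 ^ n" by auto
  note * = Suc.IH[OF k] p_strict[OF k]
  show ?case
  proof (cases "even k")
    case True
    then have "mass (Suc n) k = p n (k div 2) * mass n (k div 2)"
      using mass_left[OF k] by simp
    then show ?thesis using * by simp
  next
    case False
    then have "mass (Suc n) k = (1 - p n (k div 2)) * mass n (k div 2)"
      using mass_right[OF k] by simp
    then show ?thesis using * by simp
  qed
qed

lemma sum_mass: "(\<Sum>k<2^n. mass n k) = 1"
proof -
  have "measure M (\<Union>k<2^n. cell n k) = (\<Sum>k<2^n. mass n k)"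
    by (rule finite_measure_finite_Union) (auto simp: disjoint_family_cell)
  then show ?thesis using mass_unit by (simp add: UN_cell)
qed

text \<open>
  Second-order expansion of \<open>q powr (1 - \<theta>) = q * exp (-\<theta> * ln q)\<close> at \<open>\<theta> = 0\<close>: the linear terms of
  the two summands add up to \<open>\<theta>\<close> times the entropy. The sign of \<open>\<theta>\<close> is arbitrary, so that
  one estimate serves for both deviation bounds.
\<close>

lemma tilted_step:
  assumes k: "k < 2 ^ n" and \<theta>: "\<bar>\<theta>\<bar> * (- ln c) \<le> 1"
    and e: "\<theta> * binary_entropy (p n k) \<le> e"
  shows "p n k powr (1 - \<theta>) + (1 - p n k) powr (1 - \<theta>) \<le> exp (e + \<theta>\<^sup>2 * (ln c)\<^sup>2)"
proof -
  have tilt: "q powr (1 - \<theta>) \<le> q - \<theta> * (q * ln q) + q * (\<theta>\<^sup>2 * (ln c)\<^sup>2)"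
    if q: "c \<le> q" "q < 1" for q
  proof -
    have q0: "0 < q" using q c_pos by simp
    have l: "ln c \<le> ln q" "ln q < 0" using q q0 c_pos by auto
    \<comment> \<open>\<open>ln q\<close> lies between \<open>ln c\<close> and 0, so the quadratic
      error can be bounded independently of \<open>q\<close>.\<close>
    have "\<bar>\<theta> * ln q\<bar> \<le> \<bar>\<theta>\<bar> * (- ln c)"
      using l by (auto simp: abs_mult intro!: mult_left_mono)
    then have "exp (- \<theta> * ln q) \<le> 1 + (- \<theta> * ln q) + (- \<theta> * ln q)\<^sup>2"
      using \<theta> by (intro exp_le_quadratic) (auto simp: abs_mult)
    also have "(- \<theta> * ln q)\<^sup>2 \<le> \<theta>\<^sup>2 * (ln c)\<^sup>2"
    proof -
      have "(ln q)\<^sup>2 \<le> (ln c)\<^sup>2" using l by (simp add: abs_le_square_iff[symmetric])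
      then show ?thesis by (simp add: power_mult_distrib mult_left_mono)
    qed
    finally have "exp (- \<theta> * ln q) \<le> 1 - \<theta> * ln q + \<theta>\<^sup>2 * (ln c)\<^sup>2" by simp
    then have "q * exp (- \<theta> * ln q) \<le> q * (1 - \<theta> * ln q + \<theta>\<^sup>2 * (ln c)\<^sup>2)"
      using q0 by (intro mult_left_mono) auto
    moreover have "q powr (1 - \<theta>) = q * exp (- \<theta> * ln q)"
      using powr_add[of q 1 "- \<theta>"] q0 by (simp add: powr_def)
    ultimately show ?thesis by (simp add: algebra_simps)
  qed
  have "p n k powr (1 - \<theta>) + (1 - p n k) powr (1 - \<theta>)
      \<le> 1 + \<theta> * binary_entropy (p n k) + \<theta>\<^sup>2 * (ln c)\<^sup>2"
    using tilt[of "p n k"] tilt[of "1 - p n k"] p_bounds[OF k] p_strict[OF k]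
    by (simp add: binary_entropy_def algebra_simps)
  also have "\<dots> \<le> 1 + (e + \<theta>\<^sup>2 * (ln c)\<^sup>2)" using e by simp
  also have "\<dots> \<le> exp (e + \<theta>\<^sup>2 * (ln c)\<^sup>2)" by (rule exp_ge_add_one_self)
  finally show ?thesis .
qed

text \<open>Induction on the generation: splitting a cell multiplies its term by at most the factor
  in \<open>tilted_step\<close>. The bound \<open>e\<close> stays open to admit
  \<open>\<theta> * H\<close> for positive and \<open>\<theta> * h\<close> for negative
  \<open>\<theta>\<close>.\<close>

lemma tilted_sum:
  assumes \<theta>: "\<bar>\<theta>\<bar> * (- ln c) \<le> 1"
    and e: "\<And>n k. k < 2 ^ n \<Longrightarrow> \<theta> * binary_entropy (p n k) \<le> e"
  shows "(\<Sum>k<2^n. mass n k powr (1 - \<theta>)) \<le> exp (real n * (e + \<theta>\<^sup>2 * (ln c)\<^sup>2))"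
proof (induction n)
  case 0
  then show ?case using sum_mass[of 0] by simp
next
  case (Suc n)
  let ?E = "e + \<theta>\<^sup>2 * (ln c)\<^sup>2"
  have "(\<Sum>k<2^Suc n. mass (Suc n) k powr (1 - \<theta>))
      = (\<Sum>k<2^n. mass (Suc n) (2 * k) powr (1 - \<theta>) + mass (Suc n) (Suc (2 * k)) powr (1 - \<theta>))"
    using sum_split_parity[of "\<lambda>k. mass (Suc n) k powr (1 - \<theta>)" "2 ^ n"] by simp
  also have "\<dots> \<le> (\<Sum>k<2^n. mass n k powr (1 - \<theta>) * exp ?E)"
  proof (rule sum_mono)
    fix k :: nat assume "k \<in> {..<2^n}"
    then have k: "k < 2 ^ n" by simp
    have "mass (Suc n) (2 * k) powr (1 - \<theta>) + mass (Suc n) (Suc (2 * k)) powr (1 - \<theta>)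
        = mass n k powr (1 - \<theta>) * (p n k powr (1 - \<theta>) + (1 - p n k) powr (1 - \<theta>))"
      using p_strict[OF k] unfolding mass_left[OF k] mass_right[OF k]
      by (simp add: powr_mult distrib_left mult.commute)
    also have "\<dots> \<le> mass n k powr (1 - \<theta>) * exp ?E"
      by (intro mult_left_mono tilted_step[OF k \<theta> e[OF k]]) auto
    finally show "mass (Suc n) (2 * k) powr (1 - \<theta>) + mass (Suc n) (Suc (2 * k)) powr (1 - \<theta>)
      \<le> mass n k powr (1 - \<theta>) * exp ?E" .
  qed
  also have "\<dots> = (\<Sum>k<2^n. mass n k powr (1 - \<theta>)) * exp ?E"
    by (simp add: sum_distrib_right)
  also have "\<dots> \<le> exp (real n * ?E) * exp ?E"
    by (intro mult_right_mono Suc.IH) simp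
  also have "\<dots> = exp (real (Suc n) * ?E)"
    by (simp add: exp_add[symmetric] algebra_simps)
  finally show ?case .
qed

section \<open>Large deviations of the cell masses\<close>

text \<open>Exponential Markov inequality: a mass \<open>m\<close> equals
  \<open>m powr (1 - \<theta>) * m powr \<theta>\<close>, and on \<open>J\<close> the second factor
  is at most \<open>exp (- (\<theta> * (real n * C)))\<close>. Positive \<open>\<theta>\<close>
  treats cells of small mass, negative \<open>\<theta>\<close> cells of large mass.\<close>

lemma deviation_measure:
  assumes \<theta>: "\<bar>\<theta>\<bar> * (- ln c) \<le> 1"
    and e: "\<And>n k. k < 2 ^ n \<Longrightarrow> \<theta> * binary_entropy (p n k) \<le> e"
    and J: "J \<subseteq> {..<2^n}" "\<And>k. k \<in> J \<Longrightarrow> \<theta> * (ln (mass n k) + real n * C) \<le> 0"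
  shows "measure M (\<Union>k\<in>J. cell n k) \<le> exp (e + \<theta>\<^sup>2 * (ln c)\<^sup>2 - \<theta> * C) ^ n"
proof -
  have fin: "finite J" using J(1) finite_subset by blast
  have "measure M (\<Union>k\<in>J. cell n k) = (\<Sum>k\<in>J. mass n k)"
    using fin by (intro finite_measure_finite_Union) (auto simp: disjoint_family_cell)
  also have "\<dots> \<le> (\<Sum>k\<in>J. mass n k powr (1 - \<theta>) * exp (- (\<theta> * (real n * C))))"
  proof (rule sum_mono)
    fix k assume k: "k \<in> J"
    then have m: "0 < mass n k" using J(1) mass_pos by blast
    have "mass n k = mass n k powr (1 - \<theta>) * mass n k powr \<theta>"
      using m by (simp flip: powr_add)
    also have "mass n k powr \<theta> \<le> exp (- (\<theta> * (real n * C)))"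
      using J(2)[OF k] m by (simp add: powr_def algebra_simps)
    finally show "mass n k \<le> mass n k powr (1 - \<theta>) * exp (- (\<theta> * (real n * C)))"
      by (simp add: mult_left_mono)
  qed
  also have "\<dots> \<le> (\<Sum>k<2^n. mass n k powr (1 - \<theta>) * exp (- (\<theta> * (real n * C))))"
    using J(1) by (intro sum_mono2) auto
  also have "\<dots> = (\<Sum>k<2^n. mass n k powr (1 - \<theta>)) * exp (- (\<theta> * (real n * C)))"
    by (simp add: sum_distrib_right)
  also have "\<dots> \<le> exp (real n * (e + \<theta>\<^sup>2 * (ln c)\<^sup>2)) * exp (- (\<theta> * (real n * C)))"
    by (intro mult_right_mono tilted_sum[OF \<theta> e]) auto
  also have "\<dots> = exp (e + \<theta>\<^sup>2 * (ln c)\<^sup>2 - \<theta> * C) ^ n"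
    by (simp add: exp_add[symmetric] exp_of_nat_mult[symmetric] algebra_simps)
  finally show ?thesis .
qed

text \<open>By \<open>neg\<close>, the unions of cells with index outside \<open>J n\<close> have
  geometrically decaying mass, so the first Borel-Cantelli lemma applies.\<close>

lemma AE_eventually_cell:
  assumes \<theta>: "\<bar>\<theta>\<bar> * (- ln c) \<le> 1"
    and e: "\<And>n k. k < 2 ^ n \<Longrightarrow> \<theta> * binary_entropy (p n k) \<le> e"
    and neg: "e + \<theta>\<^sup>2 * (ln c)\<^sup>2 - \<theta> * C < 0"
    and J: "\<And>n k. k < 2 ^ n \<Longrightarrow> k \<notin> J n \<Longrightarrow> \<theta> * (ln (mass n k) + real n * C) \<le> 0"
  shows "AE x in M. eventually (\<lambda>n. x \<in> (\<Union>k\<in>J n \<inter> {..<2^n}. cell n k)) sequentially"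
proof -
  let ?A = "\<lambda>n. \<Union>k\<in>{..<2^n} - J n. cell n k"
  let ?q = "exp (e + \<theta>\<^sup>2 * (ln c)\<^sup>2 - \<theta> * C)"
  have "summable (\<lambda>n. measure M (?A n))"
  proof (rule summable_comparison_test')
    show "summable (\<lambda>n. ?q ^ n)" using neg by (intro summable_geometric) simp
    show "norm (measure M (?A n)) \<le> ?q ^ n" if "0 \<le> n" for n
      using deviation_measure[OF \<theta> e, where J = "{..<2^n} - J n" and n = n and C = C] J by auto
  qed
  moreover have "range ?A \<subseteq> sets M" by auto
  ultimately have "AE x in M. eventually (\<lambda>n. x \<in> space M - ?A n) sequentially"
    by (intro borel_cantelli_AE1) (auto simp: emeasure_eq_measure)
  \<comment> \<open>The cells cover only \<open>{0<..1}\<close>; the rest of the line is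
    null.\<close>
  moreover have "AE x in M. x \<in> {0<..1}"
    using mass_unit by (simp add: prob_eq_1)
  ultimately show ?thesis
  proof eventually_elim
    case (elim x)
    from elim(1) show ?case
    proof eventually_elim
      case (elim n)
      with \<open>x \<in> {0<..1}\<close> show ?case unfolding UN_cell[of n, symmetric] by auto
    qed
  qed
qed

text \<open>The first bound keeps exponents in the range of \<open>exp_le_quadratic\<close>; the
  second, multiplied by \<open>\<theta>\<close>, puts the quadratic error below the linear gain
  \<open>\<theta> * \<epsilon>\<close>.\<close>

lemma small_parameter:
  assumes "0 < \<epsilon>"
  obtains \<theta> where "0 < \<theta>" "\<theta> * (- ln c) \<le> 1" "\<theta> * (ln c)\<^sup>2 < \<epsilon>"
proof -
  have "((\<lambda>\<theta>. \<theta> * (- ln c)) \<longlongrightarrow> 0 * (- ln c)) (at_right 0)"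
    by (intro tendsto_intros)
  then have "eventually (\<lambda>\<theta>. \<theta> * (- ln c) < 1) (at_right 0)"
    by (rule order_tendstoD) simp
  moreover have "((\<lambda>\<theta>. \<theta> * (ln c)\<^sup>2) \<longlongrightarrow> 0 * (ln c)\<^sup>2) (at_right 0)"
    by (intro tendsto_intros)
  then have "eventually (\<lambda>\<theta>. \<theta> * (ln c)\<^sup>2 < \<epsilon>) (at_right 0)"
    by (rule order_tendstoD) (simp add: assms)
  moreover have "eventually (\<lambda>\<theta>::real. \<theta> > 0) (at_right 0)"
    by (rule eventually_at_right_less)
  ultimately have "eventually (\<lambda>\<theta>. \<theta> > 0 \<and> \<theta> * (- ln c) < 1 \<and> \<theta> * (ln c)\<^sup>2 < \<epsilon>) (at_right 0)"
    by eventually_elim auto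
  from eventually_happens'[OF _ this] obtain \<theta>
    where "\<theta> > 0 \<and> \<theta> * (- ln c) < 1 \<and> \<theta> * (ln c)\<^sup>2 < \<epsilon>" by auto
  with that[of \<theta>] show thesis by auto
qed

text \<open>Heavy cells are few, hence give cheap covers; light cells spread the mass thinly, which
  bounds the cost of covers from below.\<close>

definition heavy :: "real \<Rightarrow> nat \<Rightarrow> nat set" where
  "heavy C n = {k. k < 2 ^ n \<and> exp (- real n * C) \<le> mass n k}"

definition light :: "real \<Rightarrow> nat \<Rightarrow> nat set" where
  "light C n = {k. k < 2 ^ n \<and> mass n k \<le> exp (- real n * C)}"

lemma finite_heavy [simp]: "finite (heavy C n)" and finite_light [simp]: "finite (light C n)"
  by (auto simp: heavy_def light_def)

lemma AE_heavy:
  assumes "H < C"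
  shows "AE x in M. eventually (\<lambda>n. x \<in> (\<Union>k\<in>heavy C n. cell n k)) sequentially"
proof -
  obtain \<theta> where \<theta>: "0 < \<theta>" "\<theta> * (- ln c) \<le> 1" "\<theta> * (ln c)\<^sup>2 < C - H"
    using small_parameter[of "C - H"] assms by auto
  have neg: "\<theta> * H + \<theta>\<^sup>2 * (ln c)\<^sup>2 - \<theta> * C < 0"
    using mult_strict_left_mono[OF \<theta>(3,1)] by (simp add: algebra_simps power2_eq_square)
  have "AE x in M. eventually (\<lambda>n. x \<in> (\<Union>k\<in>heavy C n \<inter> {..<2^n}. cell n k)) sequentially"
  proof (rule AE_eventually_cell[OF _ _ neg])
    fix n k :: nat assume k: "k < 2 ^ n"
    show "\<theta> * binary_entropy (p n k) \<le> \<theta> * H"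
      using entropy_bounds[OF k] \<theta> by simp
    assume "k \<notin> heavy C n"
    then have "mass n k < exp (- real n * C)" using k by (simp add: heavy_def)
    then have "ln (mass n k) \<le> - real n * C"
      using mass_pos[OF k] by (metis ln_exp ln_le_cancel_iff less_imp_le exp_gt_zero)
    then show "\<theta> * (ln (mass n k) + real n * C) \<le> 0"
      using \<theta> by (intro mult_nonneg_nonpos) auto
  qed (use \<theta> in auto)
  moreover have "heavy C n \<inter> {..<2^n} = heavy C n" for n by (auto simp: heavy_def)
  ultimately show ?thesis by simp
qed

text \<open>The argument of \<open>AE_heavy\<close> with tilt \<open>- \<theta>\<close>: the sign
  turns the lower entropy bound \<open>h\<close> into the upper bound that
  \<open>AE_eventually_cell\<close> asks for.\<close>

lemma AE_light:
  assumes "C < h"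
  shows "AE x in M. eventually (\<lambda>n. x \<in> (\<Union>k\<in>light C n. cell n k)) sequentially"
proof -
  obtain \<theta> where \<theta>: "0 < \<theta>" "\<theta> * (- ln c) \<le> 1" "\<theta> * (ln c)\<^sup>2 < h - C"
    using small_parameter[of "h - C"] assms by auto
  have neg: "- \<theta> * h + (- \<theta>)\<^sup>2 * (ln c)\<^sup>2 - (- \<theta>) * C < 0"
    using mult_strict_left_mono[OF \<theta>(3,1)] by (simp add: algebra_simps power2_eq_square)
  have "AE x in M. eventually (\<lambda>n. x \<in> (\<Union>k\<in>light C n \<inter> {..<2^n}. cell n k)) sequentially"
  proof (rule AE_eventually_cell[OF _ _ neg])
    fix n k :: nat assume k: "k < 2 ^ n"
    show "- \<theta> * binary_entropy (p n k) \<le> - \<theta> * h"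
      using entropy_bounds[OF k] \<theta> by simp
    assume "k \<notin> light C n"
    then have "exp (- real n * C) < mass n k" using k by (simp add: light_def)
    then have "- real n * C \<le> ln (mass n k)"
      using mass_pos[OF k] by (metis ln_exp ln_le_cancel_iff less_imp_le exp_gt_zero)
    then show "- \<theta> * (ln (mass n k) + real n * C) \<le> 0"
      using \<theta> by (simp add: zero_le_mult_iff)
  qed (use \<theta> in auto)
  moreover have "light C n \<inter> {..<2^n} = light C n" for n by (auto simp: light_def)
  ultimately show ?thesis by simp
qed

text \<open>The disjoint cells of a generation share a total mass of 1.\<close>

lemma card_heavy: "real (card (heavy C n)) \<le> exp (real n * C)"
proof -
  have "real (card (heavy C n)) * exp (- real n * C) = (\<Sum>k\<in>heavy C n. exp (- real n * C))"
    by simp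
  also have "\<dots> \<le> (\<Sum>k\<in>heavy C n. mass n k)" by (intro sum_mono) (simp add: heavy_def)
  also have "\<dots> \<le> (\<Sum>k<2^n. mass n k)" by (intro sum_mono2) (auto simp: heavy_def)
  also have "\<dots> = 1" by (rule sum_mass)
  finally show ?thesis by (simp add: exp_minus field_simps)
qed

section \<open>Upper bound for the dimension\<close>

text \<open>Cover by all heavy cells of generations at least \<open>N\<close>. By
  \<open>card_heavy\<close> and \<open>gauge_cell_le\<close>, generation \<open>n\<close> costs at
  most \<open>q ^ n\<close>, and the geometric tail vanishes as \<open>N\<close> grows.\<close>

lemma hausdorff_measure_zero_heavy:
  assumes s: "0 < s" and C: "C < s * ln 2"
    and K: "\<And>x. x \<in> K \<Longrightarrow> eventually (\<lambda>n. x \<in> (\<Union>k\<in>heavy C n. cell n k)) sequentially"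
  shows "hausdorff_measure s K = 0"
proof -
  define q where "q = exp (C - s * ln 2)"
  have q: "0 < q" "q < 1" using C by (auto simp: q_def)
  have content_le: "hausdorff_content s \<delta> K \<le> ennreal (q ^ N / (1 - q))"
    if N: "1 / 2 ^ N \<le> \<delta>" for N \<delta>
  proof -
    define V where "V = (\<lambda>(n, k). if N \<le> n \<and> k \<in> heavy C n then cell n k else {})"
    define U where "U i = V (prod_decode i)" for i
    have "K \<subseteq> (\<Union>i. U i)"
    proof
      fix x assume "x \<in> K"
      from K[OF this] obtain N0 where N0: "\<And>n. N0 \<le> n \<Longrightarrow> x \<in> (\<Union>k\<in>heavy C n. cell n k)"
        unfolding eventually_sequentially by blast
      \<comment> \<open>A generation past both the scale \<open>N\<close> and the threshold of
        \<open>x\<close>.\<close>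
      obtain k where "k \<in> heavy C (max N N0)" "x \<in> cell (max N N0) k"
        using N0[of "max N N0"] by auto
      then have "x \<in> U (prod_encode (max N N0, k))" by (simp add: U_def V_def)
      then show "x \<in> (\<Union>i. U i)" by blast
    qed
    moreover have "bounded (U i) \<and> diameter (U i) \<le> \<delta>" for i
    proof -
      obtain n k where i: "prod_decode i = (n, k)" by fastforce
      have "diameter (cell n k) \<le> \<delta>" if "N \<le> n"
      proof -
        have "1 / 2 ^ n \<le> (1 / 2 ^ N :: real)" using that by (simp add: frac_le)
        then show ?thesis using diameter_cell_le[of n k] N by linarith
      qed
      moreover have "0 \<le> \<delta>" using N by (rule order_trans[rotated]) simp
      ultimately show ?thesis by (auto simp: U_def V_def i bounded_cell)
    qed
    ultimately have "hausdorff_content s \<delta> K \<le> (\<Sum>i. hausdorff_gauge s (U i))"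
      unfolding hausdorff_content_def by (intro INF_lower) auto
    also have "\<dots> = (\<Sum>n. \<Sum>k. hausdorff_gauge s (V (n, k)))"
      unfolding U_def by (rule suminf_ennreal_2dimen) (rule refl)
    also have "\<dots> \<le> (\<Sum>n. ennreal (if N \<le> n then q ^ n else 0))"
    proof (intro suminf_le summableI)
      fix n
      show "(\<Sum>k. hausdorff_gauge s (V (n, k))) \<le> ennreal (if N \<le> n then q ^ n else 0)"
      proof (cases "N \<le> n")
        case True
        have "(\<Sum>k. hausdorff_gauge s (V (n, k))) = (\<Sum>k\<in>heavy C n. hausdorff_gauge s (V (n, k)))"
          by (rule suminf_finite) (auto simp: V_def hausdorff_gauge_def)
        also have "\<dots> \<le> (\<Sum>k\<in>heavy C n. ennreal (exp (- real n * (s * ln 2))))"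
          using True gauge_cell_le[OF s] by (intro sum_mono) (simp add: V_def)
        also have "\<dots> = ennreal (real (card (heavy C n)) * exp (- real n * (s * ln 2)))"
          by (simp add: ennreal_mult ennreal_of_nat_eq_real_of_nat)
        also have "\<dots> \<le> ennreal (exp (real n * C) * exp (- real n * (s * ln 2)))"
          by (intro ennreal_leI mult_right_mono card_heavy) simp
        also have "exp (real n * C) * exp (- real n * (s * ln 2)) = q ^ n"
          by (simp add: q_def exp_add[symmetric] exp_of_nat_mult[symmetric] algebra_simps)
        finally show ?thesis using True by simp
      next
        case False
        then show ?thesis by (simp add: V_def hausdorff_gauge_def)
      qed
    qed
    also have "\<dots> = ennreal (q ^ N / (1 - q))"
    proof -
      have "(\<lambda>n. q ^ N * q ^ n) sums (q ^ N * (1 / (1 - q)))"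
        using q by (intro sums_mult geometric_sums) simp
      then have "(\<lambda>n. if N \<le> n then q ^ n else 0) sums (q ^ N / (1 - q))"
        by (subst sums_zero_iff_shift[of N, symmetric]) (auto simp: power_add mult.commute)
      then show ?thesis
        using q by (subst suminf_ennreal2) (auto simp: sums_iff)
    qed
    finally show ?thesis .
  qed
  have "hausdorff_content s \<delta> K = 0" if \<delta>: "0 < \<delta>" for \<delta>
  proof -
    have "(\<lambda>N. q ^ N / (1 - q)) \<longlonglongrightarrow> 0 / (1 - q)"
      using q by (intro tendsto_intros LIMSEQ_realpow_zero) auto
    then have "(\<lambda>N. ennreal (q ^ N / (1 - q))) \<longlonglongrightarrow> 0"
      using tendsto_ennrealI by fastforce
    moreover obtain N0 where N0: "(1/2) ^ N0 < \<delta>"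
      using real_arch_pow_inv[of \<delta> "1/2"] \<delta> by auto
    have "hausdorff_content s \<delta> K \<le> ennreal (q ^ N / (1 - q))" if "N0 \<le> N" for N
    proof (rule content_le)
      have "(1/2::real) ^ N \<le> (1/2) ^ N0" using that by (intro power_decreasing) auto
      then show "1 / 2 ^ N \<le> \<delta>" using N0 by (simp add: power_divide)
    qed
    ultimately have "hausdorff_content s \<delta> K \<le> 0"
      by (intro LIMSEQ_le_const) auto
    then show ?thesis by simp
  qed
  then show ?thesis by (simp add: hausdorff_measure_def)
qed

text \<open>\<open>K\<close> collects the points that are eventually in heavy cells for every
  \<open>C = H + 1 / real (Suc j)\<close>; discarding countably many null sets reaches the bound
  with \<open>H\<close> itself.\<close>

theorem full_measure_set_dim_le:
  "\<exists>K\<in>sets borel. emeasure M K = 1 \<and> hausdorff_dim K \<le> ereal (H / ln 2)"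
proof -
  define G where "G j n = (\<Union>k\<in>heavy (H + 1 / real (Suc j)) n. cell n k)" for j n
  define K where "K = {x. \<forall>j. eventually (\<lambda>n. x \<in> G j n) sequentially}"
  have G: "G j n \<in> sets borel" for j n
    unfolding G_def by (intro sets.finite_UN) auto
  have "x \<in> K \<longleftrightarrow> (\<forall>j. \<exists>N. \<forall>n\<in>{N..}. x \<in> G j n)" for x
    by (simp add: K_def eventually_sequentially Ball_def)
  then have "K = (\<Inter>j. \<Union>N. \<Inter>n\<in>{N..}. G j n)"
    by (intro set_eqI) simp
  also have "\<dots> \<in> sets borel"
    using G by (intro sets.countable_INT sets.countable_UN sets.countable_INT'') auto
  finally have K: "K \<in> sets borel" .
  have "AE x in M. eventually (\<lambda>n. x \<in> G j n) sequentially" for j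
    unfolding G_def by (rule AE_heavy) simp
  then have "AE x in M. x \<in> K"
    unfolding K_def by (simp add: AE_all_countable)
  then have "emeasure M K = 1"
    using K by (simp add: emeasure_eq_measure prob_eq_1)
  moreover have "hausdorff_dim K \<le> ereal (H / ln 2)"
  proof (rule dense_ge)
    fix z assume z: "ereal (H / ln 2) < z"
    show "hausdorff_dim K \<le> z"
    proof (cases z)
      case (real s)
      then have H: "H < s * ln 2" using z by (simp add: field_simps)
      \<comment> \<open>Entropy is nonnegative, so \<open>H \<ge> 0\<close> and hence
        \<open>s > 0\<close>, as \<open>hausdorff_measure_zero_heavy\<close> requires.\<close>
      have "p 0 0 * ln (p 0 0) \<le> 0" "(1 - p 0 0) * ln (1 - p 0 0) \<le> 0"
        using p_strict[of 0 0] by (auto intro!: mult_nonneg_nonpos)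
      then have "0 \<le> binary_entropy (p 0 0)"
        by (simp add: binary_entropy_def)
      then have "0 \<le> H" using entropy_bounds[of 0 0] by simp
      then have "0 < s * ln 2" using H by linarith
      then have s: "0 < s" by (simp add: zero_less_mult_iff)
      obtain j where "1 / real (Suc j) < s * ln 2 - H"
        using H nat_approx_posE[of "s * ln 2 - H"] by auto
      then have "hausdorff_measure s K = 0"
        by (intro hausdorff_measure_zero_heavy[where C = "H + 1 / real (Suc j)"] s)
          (auto simp: K_def G_def)
      then show ?thesis using s real by (simp add: ereal_hausdorff_dim_le)
    qed (use z in auto)
  qed
  ultimately show ?thesis using K by blast
qed

section \<open>Lower bound by the mass distribution principle\<close>

text \<open>Fixing the generation from which all cells around a point are light makes the estimates
  uniform; for \<open>C < h\<close> the union over \<open>N\<close> has full measure.\<close>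

definition light_from :: "real \<Rightarrow> nat \<Rightarrow> real set" where
  "light_from C N = (\<Inter>n\<in>{N..}. \<Union>k\<in>light C n. cell n k)"

lemma light_from_borel: "light_from C N \<in> sets borel"
  unfolding light_from_def by (intro sets.countable_INT'' sets.finite_UN) auto

text \<open>A set no wider than a cell meets at most one cell and its two neighbours.
  \<open>U\<close> may fail to be measurable, hence the Borel set \<open>V\<close>.\<close>

lemma light_cover_scale:
  assumes n: "N \<le> n" and U: "bounded U" "diameter U \<le> 1 / 2 ^ n"
  shows "\<exists>V\<in>sets borel. U \<inter> light_from C N \<subseteq> V \<and> measure M V \<le> 3 * exp (- real n * C)"
proof (cases "U \<inter> light_from C N = {}")
  case True
  then show ?thesis by (intro bexI[of _ "{}"]) auto
next
  case False
  then obtain x where x: "x \<in> U" "x \<in> light_from C N" by auto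
  then have "x \<in> (\<Union>k\<in>light C n. cell n k)" using n by (auto simp: light_from_def)
  then obtain j where j: "j \<in> light C n" "x \<in> cell n j" by auto
  \<comment> \<open>Subtraction truncates at \<open>j = 0\<close>, where the range has two indices
    instead of three.\<close>
  let ?J = "light C n \<inter> {j - 1..Suc j}"
  let ?V = "\<Union>k\<in>?J. cell n k"
  have "U \<inter> light_from C N \<subseteq> ?V"
  proof
    fix y assume y: "y \<in> U \<inter> light_from C N"
    then have "y \<in> (\<Union>k\<in>light C n. cell n k)" using n by (auto simp: light_from_def)
    then obtain k where k: "k \<in> light C n" "y \<in> cell n k" by auto
    \<comment> \<open>Scaled by \<open>2 ^ n\<close>, the points are at most 1 apart, so their cell
      indices differ by at most 1.\<close>
    have "\<bar>x - y\<bar> \<le> 1 / 2 ^ n"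
      using diameter_bounded_bound[OF U(1), of x y] x y U(2) by (simp add: dist_real_def)
    then have "\<bar>(x - y) * 2 ^ n\<bar> \<le> 1"
      by (simp add: abs_mult pos_le_divide_eq)
    then have "\<bar>x * 2 ^ n - y * 2 ^ n\<bar> \<le> 1"
      by (simp add: left_diff_distrib)
    moreover have "real k < y * 2 ^ n" "y * 2 ^ n \<le> real k + 1"
        "real j < x * 2 ^ n" "x * 2 ^ n \<le> real j + 1"
      using j k by (auto simp: cell_def field_simps)
    ultimately have "real k < real j + 2" "real j < real k + 2" by linarith+
    then have "k \<in> {j - 1..Suc j}" by auto
    then show "y \<in> ?V" using k by auto
  qed
  moreover have "measure M ?V \<le> 3 * exp (- real n * C)"
  proof -
    have "measure M ?V \<le> (\<Sum>k\<in>?J. mass n k)"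
      by (intro finite_measure_subadditive_finite) auto
    also have "\<dots> \<le> (\<Sum>k\<in>?J. exp (- real n * C))"
      by (intro sum_mono) (auto simp: light_def)
    also have "\<dots> = real (card ?J) * exp (- real n * C)" by simp
    also have "\<dots> \<le> 3 * exp (- real n * C)"
    proof (intro mult_right_mono)
      have "card ?J \<le> card {j - 1..Suc j}" by (intro card_mono) auto
      also have "\<dots> \<le> 3" by auto
      finally show "real (card ?J) \<le> 3" by simp
    qed simp
    finally show ?thesis .
  qed
  moreover have "?V \<in> sets borel" by (intro sets.finite_UN) auto
  ultimately show ?thesis by blast
qed

text \<open>With \<open>C = s * ln 2\<close>, a light cell of generation \<open>n\<close> has mass
  at most \<open>(1 / 2 ^ n) powr s\<close>. The 3 counts adjacent cells; \<open>2 powr s\<close> is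
  lost in rounding the diameter to a dyadic scale.\<close>

lemma light_cover_gauge:
  assumes s: "0 \<le> s" and U: "bounded U" "diameter U \<le> 1 / 2 ^ N"
  shows "\<exists>V\<in>sets borel. U \<inter> light_from (s * ln 2) N \<subseteq> V \<and>
    emeasure M V \<le> ennreal (3 * 2 powr s) * hausdorff_gauge s U"
proof -
  let ?C = "s * ln 2"
  \<comment> \<open>Diameter 0 needs its own case: the gauge of a singleton is 0 if \<open>s > 0\<close> and 1 if \<open>s = 0\<close>.\<close>
  consider "U = {}" | "U \<noteq> {}" "s = 0" | "U \<noteq> {}" "0 < s" "diameter U = 0"
    | "U \<noteq> {}" "0 < s" "0 < diameter U"
    using s diameter_ge_0[OF U(1)] by fastforce
  then show ?thesis
  proof cases
    case 1
    then show ?thesis by (intro bexI[of _ "{}"]) auto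
  next
    case 2
    have "emeasure M UNIV \<le> 1" by (rule measure_le_1)
    also have "1 \<le> ennreal (3 * 2 powr s) * hausdorff_gauge s U"
      using 2 by (simp add: hausdorff_gauge_def)
    finally show ?thesis by (intro bexI[of _ UNIV]) auto
  next
    case 3
    \<comment> \<open>Diameter 0 permits every generation \<open>n \<ge> N\<close>; intersecting the
      resulting sets leaves mass 0.\<close>
    have "\<exists>V\<in>sets borel. U \<inter> light_from ?C N \<subseteq> V \<and> measure M V \<le> 3 * exp (- real n * ?C)"
      if "N \<le> n" for n
      using 3 U by (intro light_cover_scale that) auto
    then obtain V where V: "\<And>n. N \<le> n \<Longrightarrow> V n \<in> sets borel"
        "\<And>n. N \<le> n \<Longrightarrow> U \<inter> light_from ?C N \<subseteq> V n"
        "\<And>n. N \<le> n \<Longrightarrow> measure M (V n) \<le> 3 * exp (- real n * ?C)"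
      by metis
    let ?W = "\<Inter>n\<in>{N..}. V n"
    have W: "?W \<in> sets borel" using V(1) by (intro sets.countable_INT'') auto
    have "measure M ?W \<le> 3 * exp (- ?C) ^ n" if "N \<le> n" for n
    proof -
      have "measure M ?W \<le> measure M (V n)"
        using that V(1) by (intro finite_measure_mono) auto
      then show ?thesis
        using V(3)[OF that] by (simp add: exp_of_nat_mult[symmetric])
    qed
    moreover have lim: "(\<lambda>n. 3 * exp (- ?C) ^ n) \<longlonglongrightarrow> 3 * 0"
      using 3 by (intro tendsto_intros LIMSEQ_realpow_zero) auto
    ultimately have "measure M ?W \<le> 3 * 0"
      by (intro LIMSEQ_le_const[OF lim]) blast
    then have "emeasure M ?W = 0" by (simp add: emeasure_eq_measure measure_le_0_iff)
    then show ?thesis using W V(2) by (intro bexI[of _ ?W]) auto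
  next
    case 4
    obtain n where n: "N \<le> n" "diameter U \<le> 1 / 2 ^ n" "1 / 2 ^ n < 2 * diameter U"
      using ex_cell_scale[OF 4(3) U(2)] .
    obtain V where V: "V \<in> sets borel" "U \<inter> light_from ?C N \<subseteq> V"
        "measure M V \<le> 3 * exp (- real n * ?C)"
      using light_cover_scale[OF n(1) U(1) n(2)] by blast
    have "exp (- real n * ?C) = (1 / 2 ^ n) powr s"
      by (simp add: powr_def ln_div ln_realpow algebra_simps)
    also have "\<dots> \<le> (2 * diameter U) powr s"
      using n 4 by (intro powr_mono2) auto
    also have "\<dots> = 2 powr s * diameter U powr s"
      using 4 by (simp add: powr_mult)
    finally have "measure M V \<le> 3 * 2 powr s * diameter U powr s"
      using V(3) by simp
    then have "emeasure M V \<le> ennreal (3 * 2 powr s * diameter U powr s)"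
      by (simp add: emeasure_eq_measure ennreal_leI)
    also have "\<dots> = ennreal (3 * 2 powr s) * hausdorff_gauge s U"
      using 4 by (simp add: hausdorff_gauge_def ennreal_mult)
    finally show ?thesis using V by blast
  qed
qed

text \<open>Every fine cover of \<open>K\<close> costs at least a fixed multiple of the mass of
  \<open>K \<inter> ?A N\<close>, so zero Hausdorff measure forces zero mass there; the sets
  \<open>?A N\<close> contain almost every point.\<close>

theorem null_set_if_dim_less:
  assumes K: "K \<in> sets borel" and dim: "hausdorff_dim K < ereal (h / ln 2)"
  shows "emeasure M K = 0"
proof -
  obtain s where s: "0 \<le> s" "hausdorff_measure s K = 0" "s < h / ln 2"
    using dim unfolding hausdorff_dim_def Inf_less_iff by auto
  let ?C = "s * ln 2"
  let ?A = "light_from ?C"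
  have "emeasure M (K \<inter> ?A N) = 0" for N
  proof -
    let ?c = "3 * 2 powr s"
    let ?cov = "{U. K \<subseteq> (\<Union>i::nat. U i) \<and> (\<forall>i. bounded (U i) \<and> diameter (U i) \<le> 1 / 2 ^ N)}"
    \<comment> \<open>With the constant on the left, this is a lower bound for each cover, as the
      infimum in \<open>hausdorff_content\<close> needs.\<close>
    have "ennreal (1 / ?c) * emeasure M (K \<inter> ?A N) \<le> (\<Sum>i. hausdorff_gauge s (U i))"
      if U: "U \<in> ?cov" for U
    proof -
      have "\<exists>V\<in>sets borel. U i \<inter> ?A N \<subseteq> V \<and> emeasure M V \<le> ennreal ?c * hausdorff_gauge s (U i)"
        for i
        using U by (intro light_cover_gauge s) auto
      then obtain V where V: "\<And>i. V i \<in> sets borel" "\<And>i. U i \<inter> ?A N \<subseteq> V i"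
          "\<And>i. emeasure M (V i) \<le> ennreal ?c * hausdorff_gauge s (U i)"
        by metis
      have "K \<inter> ?A N \<subseteq> (\<Union>i. V i)" using U V(2) by blast
      then have "emeasure M (K \<inter> ?A N) \<le> emeasure M (\<Union>i. V i)"
        using V(1) by (intro emeasure_mono sets.countable_UN) auto
      also have "\<dots> \<le> (\<Sum>i. emeasure M (V i))"
        using V(1) by (intro emeasure_subadditive_countably) auto
      also have "\<dots> \<le> (\<Sum>i. ennreal ?c * hausdorff_gauge s (U i))"
        using V(3) by (intro suminf_le summableI) auto
      also have "\<dots> = ennreal ?c * (\<Sum>i. hausdorff_gauge s (U i))" by simp
      finally have "ennreal (1 / ?c) * emeasure M (K \<inter> ?A N)
          \<le> ennreal (1 / ?c) * (ennreal ?c * (\<Sum>i. hausdorff_gauge s (U i)))"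
        by (intro mult_left_mono) auto
      also have "\<dots> = ennreal (1 / ?c * ?c) * (\<Sum>i. hausdorff_gauge s (U i))"
        by (subst ennreal_mult) (auto simp: mult.assoc)
      finally show ?thesis by simp
    qed
    then have "ennreal (1 / ?c) * emeasure M (K \<inter> ?A N) \<le> hausdorff_content s (1 / 2 ^ N) K"
      unfolding hausdorff_content_def by (rule INF_greatest)
    also have "\<dots> \<le> hausdorff_measure s K"
      unfolding hausdorff_measure_def by (intro SUP_upper) simp
    finally show ?thesis using s(2) by (simp add: ennreal_eq_0_iff)
  qed
  then have "K \<inter> ?A N \<in> null_sets M" for N
    using K light_from_borel[of ?C N] by (simp add: null_sets_def)
  then have "AE x in M. x \<notin> K \<inter> ?A N" for N
    by (rule AE_not_in)
  then have "AE x in M. \<forall>N. x \<notin> K \<inter> ?A N"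
    unfolding AE_all_countable by blast
  moreover have "AE x in M. eventually (\<lambda>n. x \<in> (\<Union>k\<in>light ?C n. cell n k)) sequentially"
    using s by (intro AE_light) (simp add: field_simps)
  then have "AE x in M. \<exists>N. x \<in> ?A N"
    by eventually_elim (auto simp: light_from_def eventually_sequentially)
  ultimately have "AE x in M. x \<notin> K" by eventually_elim auto
  then show ?thesis using K by (simp add: AE_iff_null null_sets_def)
qed

end

section \<open>De Rham functions\<close>

text \<open>On \<open>{0..1}\<close> the value is a convex combination of \<open>d\<close> and
  \<open>c + d\<close>.\<close>

lemma affine_pos:
  fixes c d z :: real
  assumes "0 < d" "0 < c + d" "z \<in> {0..1}"
  shows "0 < c * z + d"
proof -
  have "c * z + d = (1 - z) * d + z * (c + d)" by (simp add: algebra_simps)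
  also have "\<dots> > 0"
    using assms by (cases "z = 0") (auto intro!: add_nonneg_pos)
  finally show ?thesis .
qed

text \<open>The product of the matrices with rows \<open>(P, Q)\<close>, \<open>(y, 1)\<close> and
  \<open>(a, b)\<close>, \<open>(c, d)\<close> has lower right entry \<open>b * y + d\<close>;
  dividing by it restores the normal form.\<close>

lemma mobius_compose:
  fixes P Q y a b c d z :: real
  assumes "c * z + d \<noteq> 0" "b * y + d \<noteq> 0"
  shows "(P * ((a * z + b) / (c * z + d)) + Q) / (y * ((a * z + b) / (c * z + d)) + 1)
    = ((P * a + Q * c) / (b * y + d) * z + (P * b + Q * d) / (b * y + d)) /
      ((a * y + c) / (b * y + d) * z + 1)"
proof -
  let ?X = "P * (a * z + b) + Q * (c * z + d)" and ?Z = "y * (a * z + b) + (c * z + d)"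
  have "u * (N / D) + v = (u * N + v * D) / D" if "D \<noteq> 0" for u v N D :: real
    using that by (simp add: add_divide_distrib)
  from this[OF assms(1), of P "a * z + b" Q] this[OF assms(1), of y "a * z + b" 1]
  have "(P * ((a * z + b) / (c * z + d)) + Q) / (y * ((a * z + b) / (c * z + d)) + 1)
      = (?X / (c * z + d)) / (?Z / (c * z + d))" by simp
  also have "\<dots> = ?X / ?Z" using assms(1) by simp
  also have "\<dots> = (?X / (b * y + d)) / (?Z / (b * y + d))" using assms(2) by simp
  also have "?X / (b * y + d) = (P * a + Q * c) / (b * y + d) * z + (P * b + Q * d) / (b * y + d)"
    by (simp add: add_divide_distrib[symmetric] algebra_simps)
  also have "?Z / (b * y + d) = (a * y + c) / (b * y + d) * z + 1"
    using assms(2) by (simp add: field_simps)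
  finally show ?thesis .
qed

locale de_rham =
  fixes A0 A1 :: "real^2^2" and f :: "real \<Rightarrow> real"
  assumes A1: "cond_A1 A0 A1"
    and A2: "cond_A2 A0" "cond_A2 A1"
    and A3: "cond_A3 A0" "cond_A3 A1"
    and f: "de_rham_function A0 A1 f"
begin

section \<open>Coefficient inequalities and the invariant interval\<close>

abbreviation "a0 \<equiv> A0$1$1"
abbreviation "c0 \<equiv> A0$2$1"
abbreviation "d0 \<equiv> A0$2$2"
abbreviation "a1 \<equiv> A1$1$1"
abbreviation "b1 \<equiv> A1$1$2"
abbreviation "c1 \<equiv> A1$2$1"
abbreviation "d1 \<equiv> A1$2$2"

lemma b0 [simp]: "A0$1$2 = 0"
  using A1 by (simp add: cond_A1_def)

text \<open>By (A3) each quantity exceeds the root of a determinant, positive by (A2).\<close>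

lemma denominators_pos: "0 < d0" "0 < c0 + d0" "0 < d1" "0 < c1 + d1"
proof -
  have "0 < sqrt (a0 * d0)" "0 < sqrt (a1 * d1 - b1 * c1)"
    using A2 by (simp_all add: cond_A2_def)
  moreover have "sqrt (a0 * d0) < d0" "sqrt (a0 * d0) < c0 + d0"
    "sqrt (a1 * d1 - b1 * c1) < d1" "sqrt (a1 * d1 - b1 * c1) < c1 + d1"
    using A3 by (simp_all add: cond_A3_def)
  ultimately show "0 < d0" "0 < c0 + d0" "0 < d1" "0 < c1 + d1" by linarith+
qed

lemma coefficient_bounds:
  "0 < a0" "0 < b1" "b1 < d1" "a0 < c0 + d0" "a1 = c1 + d1 - b1"
proof -
  have *: "0 < a0 / (c0 + d0)" "a0 / (c0 + d0) = b1 / d1" "b1 / d1 < 1" "(a1 + b1) / (c1 + d1) = 1"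
    using A1 by (auto simp: cond_A1_def)
  show "0 < a0" using *(1) denominators_pos by (simp add: zero_less_divide_iff)
  show "0 < b1" using *(1,2) denominators_pos by (simp add: zero_less_divide_iff)
  show "b1 < d1" using *(3) denominators_pos by simp
  have "a0 / (c0 + d0) < 1" using * by simp
  then show "a0 < c0 + d0" using denominators_pos by simp
  show "a1 = c1 + d1 - b1" using *(4) denominators_pos by (simp add: field_simps)
qed

text \<open>(A3) at the fixed points 0 of \<open>Phi A0\<close> and 1 of \<open>Phi A1\<close>,
  where the derivatives are below 1. Eliminating \<open>a1\<close> makes the determinant of
  \<open>A1\<close> divisible by \<open>c1 + d1\<close>.\<close>

lemma contraction_bounds: "a0 < d0" "0 < b1 + c1"
proof -
  have sq: "x < y\<^sup>2" if "0 < x" "sqrt x < y" for x y :: real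
    using that by (metis real_sqrt_ge_0_iff real_sqrt_pow2 less_imp_le power_strict_mono pos2)
  have "a0 * d0 < d0\<^sup>2"
    using A2 A3 by (intro sq) (auto simp: cond_A2_def cond_A3_def)
  then show "a0 < d0" using denominators_pos by (simp add: power2_eq_square)
  have "a1 * d1 - b1 * c1 < (c1 + d1)\<^sup>2"
    using A2 A3 by (intro sq) (auto simp: cond_A2_def cond_A3_def)
  moreover have "a1 * d1 - b1 * c1 = (d1 - b1) * (c1 + d1)"
    by (simp add: coefficient_bounds(5) algebra_simps)
  ultimately have "d1 - b1 < c1 + d1"
    using denominators_pos by (simp add: power2_eq_square)
  then show "0 < b1 + c1" by simp
qed

abbreviation "\<alpha> \<equiv> alpha A0 A1"
abbreviation "\<beta> \<equiv> beta A0 A1"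

lemma alpha_beta_bounds:
  "- 1 < \<alpha>" "\<alpha> \<le> 0" "0 \<le> \<beta>" "\<alpha> * (d0 - a0) \<le> c0" "c0 \<le> \<beta> * (d0 - a0)"
  "\<alpha> * b1 \<le> c1" "c1 \<le> \<beta> * b1"
proof -
  note pos = denominators_pos coefficient_bounds contraction_bounds
  show "\<alpha> \<le> 0" "0 \<le> \<beta>" by (auto simp: alpha_def beta_def)
  have "- 1 < c0 / (d0 - a0)" "- 1 < c1 / b1"
    using pos by (auto simp: field_simps)
  then show "- 1 < \<alpha>" by (simp add: alpha_def)
  have "\<alpha> \<le> c0 / (d0 - a0)" "c0 / (d0 - a0) \<le> \<beta>" "\<alpha> \<le> c1 / b1" "c1 / b1 \<le> \<beta>"
    by (auto simp: alpha_def beta_def)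
  then show "\<alpha> * (d0 - a0) \<le> c0" "c0 \<le> \<beta> * (d0 - a0)" "\<alpha> * b1 \<le> c1" "c1 \<le> \<beta> * b1"
    using pos by (auto simp: field_simps)
qed

text \<open>The map is affine and increasing; at \<open>\<alpha>\<close> and \<open>\<beta>\<close>
  the inequalities of \<open>alpha_beta_bounds\<close> point inward.\<close>

lemma left_map_invariant:
  assumes "y \<in> {\<alpha>..\<beta>}"
  shows "(a0 * y + c0) / d0 \<in> {\<alpha>..\<beta>}"
proof -
  have "a0 * \<alpha> \<le> a0 * y" "a0 * y \<le> a0 * \<beta>"
    using assms coefficient_bounds by auto
  then have "\<alpha> * d0 \<le> a0 * y + c0" "a0 * y + c0 \<le> \<beta> * d0"
    using alpha_beta_bounds by (auto simp: algebra_simps)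
  then show ?thesis using denominators_pos by (simp add: field_simps)
qed

lemma right_denominator_pos:
  assumes "- 1 < y"
  shows "0 < b1 * y + d1"
proof -
  have "b1 * y + d1 = b1 * (y + 1) + (d1 - b1)" by (simp add: algebra_simps)
  also have "\<dots> > 0" using assms coefficient_bounds by (intro add_pos_pos) auto
  finally show ?thesis .
qed

lemma right_map_invariant:
  assumes y: "y \<in> {\<alpha>..\<beta>}"
  shows "(a1 * y + c1) / (b1 * y + d1) \<in> {\<alpha>..\<beta>}"
proof -
  have y1: "0 < y + 1" using y alpha_beta_bounds by simp
  \<comment> \<open>For \<open>e = \<alpha>\<close> both summands are nonnegative, for
    \<open>e = \<beta>\<close> both are nonpositive.\<close>
  have eq: "a1 * y + c1 - e * (b1 * y + d1) = (c1 - e * b1) * (y + 1) + (d1 - b1) * (y - e)" for e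
    by (simp add: coefficient_bounds(5) algebra_simps)
  have "0 \<le> a1 * y + c1 - \<alpha> * (b1 * y + d1)"
    unfolding eq using y y1 alpha_beta_bounds coefficient_bounds by simp
  moreover have "a1 * y + c1 - \<beta> * (b1 * y + d1) \<le> 0"
    unfolding eq using y y1 alpha_beta_bounds coefficient_bounds
    by (intro add_nonpos_nonpos mult_nonpos_nonneg mult_nonneg_nonpos) auto
  ultimately show ?thesis
    using right_denominator_pos[of y] y1 by (simp add: field_simps)
qed

section \<open>Values of \<open>f\<close> and their dyadic representation\<close>

lemma f_range: "t \<in> {0..1} \<Longrightarrow> f t \<in> {0..1}"
  using f unfolding de_rham_function_def by blast

text \<open>The summand 0 keeps the shape of \<open>mobius_compose\<close> with
  \<open>b = 0\<close>.\<close>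

lemma f_left: "t \<in> {0..1} \<Longrightarrow> f (t / 2) = (a0 * f t + 0) / (c0 * f t + d0)"
  using f unfolding de_rham_function_def Phi_def by (auto dest: spec[of _ "t / 2"])

lemma f_right: "t \<in> {0..1} \<Longrightarrow> f ((1 + t) / 2) = (a1 * f t + b1) / (c1 * f t + d1)"
proof -
  assume t: "t \<in> {0..1}"
  have "2 * ((1 + t) / 2) - 1 = t" by (simp add: field_simps)
  moreover have "1 / 2 \<le> (1 + t) / 2" "(1 + t) / 2 \<le> 1" using t by auto
  ultimately show ?thesis using f unfolding de_rham_function_def Phi_def by metis
qed

text \<open>The fixed point equation factors as \<open>z * (c0 * z + (d0 - a0)) = 0\<close>, and the
  second factor is positive at both endpoints of \<open>{0..1}\<close>, hence on it.\<close>

lemma f_0: "f 0 = 0"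
proof -
  have z: "f 0 \<in> {0..1}" by (rule f_range) simp
  have "0 < c0 * f 0 + (d0 - a0)"
    using denominators_pos coefficient_bounds contraction_bounds
    by (intro affine_pos z) auto
  moreover have "f 0 * (c0 * f 0 + d0) = a0 * f 0"
    using f_left[of 0] affine_pos[OF denominators_pos(1,2) z] by (simp add: field_simps)
  then have "f 0 * (c0 * f 0 + (d0 - a0)) = 0" by (simp add: algebra_simps)
  ultimately show ?thesis by simp
qed

lemma f_1: "f 1 = 1"
proof -
  have z: "f 1 \<in> {0..1}" by (rule f_range) simp
  have "0 < c1 * f 1 + b1"
    using coefficient_bounds contraction_bounds by (intro affine_pos z) auto
  moreover have "f 1 * (c1 * f 1 + d1) = a1 * f 1 + b1"
    using f_right[of 1] affine_pos[OF denominators_pos(3,4) z] by (simp add: field_simps)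
  then have "(f 1 - 1) * (c1 * f 1 + b1) = 0"
    by (simp add: coefficient_bounds(5) algebra_simps)
  ultimately show ?thesis by simp
qed

lemma f_half: "f (1 / 2) = 1 / gamma A0"
  using f_left[of 1] by (simp add: f_1 gamma_def Phi_def)

lemma gamma_gt_1: "1 < gamma A0"
  using denominators_pos coefficient_bounds by (simp add: gamma_def Phi_def)

text \<open>
  Matrix products are normalised to lower right entry 1, so that \<open>y\<close> is the lower left entry.
\<close>

lemma dyadic_representation:
  assumes "k < 2 ^ n"
  shows "\<exists>P Q y. y \<in> {\<alpha>..\<beta>} \<and>
    (\<forall>t\<in>{0..1}. f ((real k + t) / 2 ^ n) = (P * f t + Q) / (y * f t + 1))"
  using assms
proof (induction n arbitrary: k)
  case 0
  show ?case
    using 0 alpha_beta_bounds by (intro exI[of _ 1] exI[of _ 0]) auto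
next
  case (Suc n)
  \<comment> \<open>Cell \<open>j\<close> is the parent; the parameter \<open>t\<close> of the child
    becomes \<open>t / 2\<close> or \<open>(1 + t) / 2\<close> in it.\<close>
  define j where "j = k div 2"
  have "j < 2 ^ n" using Suc.prems by (auto simp: j_def)
  then obtain P Q y where y: "y \<in> {\<alpha>..\<beta>}"
    and rep: "\<And>t. t \<in> {0..1} \<Longrightarrow> f ((real j + t) / 2 ^ n) = (P * f t + Q) / (y * f t + 1)"
    using Suc.IH by metis
  show ?case
  proof (cases "even k")
    case True
    then have k: "real k = 2 * real j" by (auto simp: j_def)
    have "f ((real k + t) / 2 ^ Suc n) =
        ((P * a0 + Q * c0) / (0 * y + d0) * f t + (P * 0 + Q * d0) / (0 * y + d0)) /
        ((a0 * y + c0) / (0 * y + d0) * f t + 1)" if t: "t \<in> {0..1}" for t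
    proof -
      have "(real k + t) / 2 ^ Suc n = (real j + t / 2) / 2 ^ n"
        by (simp add: k field_simps)
      then have "f ((real k + t) / 2 ^ Suc n) = (P * f (t / 2) + Q) / (y * f (t / 2) + 1)"
        using rep[of "t / 2"] t by simp
      also note f_left[OF t]
      also note mobius_compose
      finally show ?thesis
        using affine_pos[OF denominators_pos(1,2) f_range[OF t]] denominators_pos by simp
    qed
    moreover have "(a0 * y + c0) / (0 * y + d0) \<in> {\<alpha>..\<beta>}"
      using left_map_invariant[OF y] by simp
    ultimately show ?thesis by blast
  next
    case False
    then have k: "real k = 2 * real j + 1" by (auto simp: j_def elim!: oddE)
    have "f ((real k + t) / 2 ^ Suc n) =
        ((P * a1 + Q * c1) / (b1 * y + d1) * f t + (P * b1 + Q * d1) / (b1 * y + d1)) /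
        ((a1 * y + c1) / (b1 * y + d1) * f t + 1)" if t: "t \<in> {0..1}" for t
    proof -
      have "(real k + t) / 2 ^ Suc n = (real j + (1 + t) / 2) / 2 ^ n"
        by (simp add: k field_simps)
      then have "f ((real k + t) / 2 ^ Suc n)
          = (P * f ((1 + t) / 2) + Q) / (y * f ((1 + t) / 2) + 1)"
        using rep[of "(1 + t) / 2"] t by simp
      also note f_right[OF t]
      also note mobius_compose
      finally show ?thesis
        using affine_pos[OF denominators_pos(3,4) f_range[OF t]] right_denominator_pos[of y]
          y alpha_beta_bounds by simp
    qed
    then show ?thesis using right_map_invariant[OF y] by blast
  qed
qed

text \<open>Evaluate the representation at \<open>t = 0\<close>, \<open>1 / 2\<close>,
  \<open>1\<close>: both increments have numerator \<open>P - y * Q\<close>, over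
  \<open>y + gamma A0\<close> and \<open>y + 1\<close>, so their ratio is
  \<open>p0 A0 y\<close>.\<close>

lemma conditional_ratio:
  assumes k: "k < 2 ^ n"
  shows "\<exists>y\<in>{\<alpha>..\<beta>}. f ((real k + 1 / 2) / 2 ^ n) - f (real k / 2 ^ n) =
    p0 A0 y * (f (real (Suc k) / 2 ^ n) - f (real k / 2 ^ n))"
proof -
  obtain P Q y where y: "y \<in> {\<alpha>..\<beta>}"
    and rep: "\<And>t. t \<in> {0..1} \<Longrightarrow> f ((real k + t) / 2 ^ n) = (P * f t + Q) / (y * f t + 1)"
    using dyadic_representation[OF k] by metis
  let ?g = "gamma A0"
  have y1: "0 < y + 1" using y alpha_beta_bounds by simp
  have yg: "0 < y + ?g" using y1 gamma_gt_1 by simp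
  have 0: "f (real k / 2 ^ n) = Q" using rep[of 0] by (simp add: f_0)
  have 1: "f (real (Suc k) / 2 ^ n) = (P + Q) / (y + 1)"
    using rep[of 1] by (simp add: f_1 add.commute)
  have "f ((real k + 1 / 2) / 2 ^ n) = (P * (1 / ?g) + Q) / (y * (1 / ?g) + 1)"
    using rep[of "1 / 2"] by (simp add: f_half)
  also have "\<dots> = ((P + Q * ?g) / ?g) / ((y + ?g) / ?g)"
    using gamma_gt_1 by (simp add: add_divide_distrib)
  also have "\<dots> = (P + Q * ?g) / (y + ?g)"
    using gamma_gt_1 by simp
  finally have "f ((real k + 1 / 2) / 2 ^ n) - f (real k / 2 ^ n) = (P - y * Q) / (y + ?g)"
    using yg 0 by (simp add: field_simps)
  moreover have "f (real (Suc k) / 2 ^ n) - f (real k / 2 ^ n) = (P - y * Q) / (y + 1)"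
    using y1 0 1 by (simp add: field_simps)
  ultimately show ?thesis
    using y y1 by (intro bexI[of _ y]) (auto simp: p0_def)
qed

section \<open>Extremal entropies and transfer to the measure\<close>

lemma p0_mono: "- 1 < x \<Longrightarrow> x \<le> y \<Longrightarrow> p0 A0 x \<le> p0 A0 y"
proof -
  assume x: "- 1 < x" "x \<le> y"
  have "(gamma A0 - 1) * x \<le> (gamma A0 - 1) * y"
    using x gamma_gt_1 by (intro mult_left_mono) auto
  then have "(x + 1) * (y + gamma A0) \<le> (y + 1) * (x + gamma A0)"
    by (simp add: algebra_simps)
  then show ?thesis using x gamma_gt_1 by (simp add: p0_def field_simps)
qed

lemma p0_strict: "- 1 < x \<Longrightarrow> 0 < p0 A0 x \<and> p0 A0 x < 1"
  using gamma_gt_1 by (simp add: p0_def field_simps)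

abbreviation "entropies \<equiv> {binary_entropy (p0 A0 y) | y. y \<in> {\<alpha>..\<beta>}}"

text \<open>Compactness supplies the extrema; without them \<open>LEAST\<close> and
  \<open>GREATEST\<close> would be unspecified.\<close>

lemma entropies_attained:
  obtains u v where "u \<in> {\<alpha>..\<beta>}" "v \<in> {\<alpha>..\<beta>}"
    "\<And>y. y \<in> {\<alpha>..\<beta>} \<Longrightarrow>
      binary_entropy (p0 A0 u) \<le> binary_entropy (p0 A0 y) \<and>
      binary_entropy (p0 A0 y) \<le> binary_entropy (p0 A0 v)"
proof -
  have ne: "{\<alpha>..\<beta>} \<noteq> {}" using alpha_beta_bounds by simp
  have "continuous_on {\<alpha>..\<beta>} (p0 A0)"
    unfolding p0_def using alpha_beta_bounds gamma_gt_1 by (intro continuous_intros) auto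
  moreover have "p0 A0 y \<noteq> 0 \<and> 1 - p0 A0 y \<noteq> 0" if "y \<in> {\<alpha>..\<beta>}" for y
    using p0_strict[of y] that alpha_beta_bounds by auto
  ultimately have cont: "continuous_on {\<alpha>..\<beta>} (\<lambda>y. binary_entropy (p0 A0 y))"
    unfolding binary_entropy_def by (intro continuous_intros) auto
  show thesis
    using continuous_attains_sup[OF _ ne cont] continuous_attains_inf[OF _ ne cont] that
    by (metis compact_Icc)
qed

lemma dyadic_entropy_measure:
  assumes \<mu>: "unit_interval_distribution f \<mu>"
  shows "\<exists>p c. dyadic_entropy \<mu> p c (LEAST m. m \<in> entropies) (GREATEST m. m \<in> entropies)"
proof -
  interpret real_distribution \<mu> using \<mu> by (simp add: unit_interval_distribution_def)
  obtain u v where uv: "u \<in> {\<alpha>..\<beta>}" "v \<in> {\<alpha>..\<beta>}"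
    "\<And>y. y \<in> {\<alpha>..\<beta>} \<Longrightarrow>
      binary_entropy (p0 A0 u) \<le> binary_entropy (p0 A0 y) \<and>
      binary_entropy (p0 A0 y) \<le> binary_entropy (p0 A0 v)"
    using entropies_attained by blast
  have Least: "(LEAST m. m \<in> entropies) = binary_entropy (p0 A0 u)"
    by (rule Least_equality) (use uv in blast)+
  have Greatest: "(GREATEST m. m \<in> entropies) = binary_entropy (p0 A0 v)"
    by (rule Greatest_equality) (use uv in blast)+
  have Ioc: "measure \<mu> {x<..y} = f y - f x" if "0 \<le> x" "x < y" "y \<le> 1" for x y
    using cdf_diff_eq[of x y] that \<mu> by (simp add: unit_interval_distribution_def)
  have "\<exists>y\<in>{\<alpha>..\<beta>}. measure \<mu> (cell (Suc n) (2 * k)) = p0 A0 y * measure \<mu> (cell n k)"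
    if k: "k < 2 ^ n" for n k
  proof -
    have k1: "real (Suc k) \<le> 2 ^ n" using k by (metis Suc_leI of_nat_le_iff of_nat_numeral of_nat_power)
    have "cell (Suc n) (2 * k) = {real k / 2 ^ n <.. (real k + 1 / 2) / 2 ^ n}"
      by (simp add: cell_def field_simps)
    then have "measure \<mu> (cell (Suc n) (2 * k))
        = f ((real k + 1 / 2) / 2 ^ n) - f (real k / 2 ^ n)"
      using k1 by (simp add: Ioc divide_strict_right_mono)
    moreover have "measure \<mu> (cell n k) = f (real (Suc k) / 2 ^ n) - f (real k / 2 ^ n)"
      using k1 unfolding cell_def by (intro Ioc) (auto simp: divide_strict_right_mono)
    ultimately show ?thesis using conditional_ratio[OF k] by simp
  qed
  then have "\<forall>n k. \<exists>y. k < 2 ^ n \<longrightarrow> y \<in> {\<alpha>..\<beta>} \<and>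
      measure \<mu> (cell (Suc n) (2 * k)) = p0 A0 y * measure \<mu> (cell n k)"
    by blast
  then obtain w where w: "\<And>n k. k < 2 ^ n \<Longrightarrow> w n k \<in> {\<alpha>..\<beta>}"
    "\<And>n k. k < 2 ^ n \<Longrightarrow>
      measure \<mu> (cell (Suc n) (2 * k)) = p0 A0 (w n k) * measure \<mu> (cell n k)"
    by metis
  \<comment> \<open>\<open>p0 A0\<close> is increasing, so its distance from 0 and from 1 on the
    interval is smallest at the endpoints.\<close>
  let ?c = "min (p0 A0 \<alpha>) (1 - p0 A0 \<beta>)"
  have "dyadic_entropy \<mu> (\<lambda>n k. p0 A0 (w n k)) ?c
    (binary_entropy (p0 A0 u)) (binary_entropy (p0 A0 v))"
  proof
    show "measure \<mu> {0<..1} = 1" by (simp add: Ioc f_0 f_1)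
    show "0 < ?c"
      using p0_strict[of \<alpha>] p0_strict[of \<beta>] alpha_beta_bounds by simp
    fix n k :: nat assume k: "k < 2 ^ n"
    show "measure \<mu> (cell (Suc n) (2 * k)) = p0 A0 (w n k) * measure \<mu> (cell n k)"
      using w(2)[OF k] .
    show "?c \<le> p0 A0 (w n k) \<and> p0 A0 (w n k) \<le> 1 - ?c"
      using p0_mono[of \<alpha> "w n k"] p0_mono[of "w n k" \<beta>] w(1)[OF k] alpha_beta_bounds by auto
    show "binary_entropy (p0 A0 u) \<le> binary_entropy (p0 A0 (w n k)) \<and>
        binary_entropy (p0 A0 (w n k)) \<le> binary_entropy (p0 A0 v)"
      using uv(3) w(1)[OF k] by blast
  qed
  then show ?thesis unfolding Least Greatest by blast
qed

end

theorem theorem1p1: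
  fixes A0 A1 :: "real^2^2" and f :: "real \<Rightarrow> real" and \<mu> :: "real measure"
  assumes "cond_A1 A0 A1"
    and "cond_A2 A0" and "cond_A2 A1"
    and "cond_A3 A0" and "cond_A3 A1"
    and "de_rham_function A0 A1 f"
    and "unit_interval_distribution f \<mu>"
  shows "(\<exists>K0 \<in> sets borel. emeasure \<mu> K0 = 1 \<and>
            hausdorff_dim K0 \<le>
              ereal ((GREATEST m. m \<in> {binary_entropy (p0 A0 y) | y. y \<in> {alpha A0 A1..beta A0 A1}}) / ln 2)) \<and>
         (\<forall>K \<in> sets borel.
            hausdorff_dim K <
              ereal ((LEAST m. m \<in> {binary_entropy (p0 A0 y) | y. y \<in> {alpha A0 A1..beta A0 A1}}) / ln 2)
            \<longrightarrow> emeasure \<mu> K = 0)"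
proof -
  interpret de_rham A0 A1 f using assms(1-6) by (rule de_rham.intro)
  obtain p c where "dyadic_entropy \<mu> p c (LEAST m. m \<in> entropies) (GREATEST m. m \<in> entropies)"
    using dyadic_entropy_measure[OF assms(7)] by blast
  then interpret dyadic_entropy \<mu> p c "LEAST m. m \<in> entropies" "GREATEST m. m \<in> entropies" .
  show ?thesis
    by (intro conjI ballI impI full_measure_set_dim_le) (rule null_set_if_dim_less)
qed

end
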